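(* Let $\mathcal{G}$ be a strongly connected and weight-balanced weighted digraph on $N$ nodes with Laplacian $L=[L_{ij}]$, and let $\alpha,\beta>0$. If the stepsize satisfies $\delta\in\big(0,\min\{\alpha^{-1},\beta^{-1}(d_{\max}^{\rm out})^{-1}\}\big)$, then the trajectory of the discrete-time system $$x^i(k+1)=x^i(k)-\delta\alpha x^i(k)-\delta\beta\sum_{j=1}^N L_{ij}x^j(k)-\delta v^i(k),\qquad v^i(k+1)=v^i(k)+\delta\alpha\beta\sum_{j=1}^N L_{ij}x^j(k),$$ $i\in\{1,\dots,N\}$, starting from any initial condition $x(0),v(0)\in\mathbb{R}^N$ satisfies, for all $i\in\{1,\dots,N\}$, $$x^i(k)\to-\frac{\alpha^{-1}}{N}\sum_{j=1}^N v^j(0),\qquad v^i(k)\to\frac1N\sum_{j=1}^N v^j(0),\qquad\text{as }k\to\infty.$$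
   Context: Weighted digraph $\mathcal{G}$ on nodes $\{1,\dots,N\}$, $N\ge2$: adjacency matrix $\mathsf{A}=[a_{ij}]$ with $a_{ij}>0$ if $(i,j)$ is an edge and $a_{ij}=0$ otherwise. Weight-balanced: $\sum_j a_{ij}=\sum_j a_{ji}$ for every $i$. Weighted out-degree $d^{\rm out}(i)=\sum_j a_{ij}$ and $d_{\max}^{\rm out}=\max_i d^{\rm out}(i)$. Laplacian: $L=D^{\rm out}-\mathsf{A}$, where $D^{\rm out}$ is diagonal with entries $d^{\rm out}(i)$. *)

theory Defs
  imports "HOL-Analysis.Analysis" "Graph_Theory.Digraph_Component"
begin

text \<open>
  The nodes \<open>1, \<dots>, N\<close> are the elements of a finite type \<open>'n\<close>, so \<open>N = CARD('n)\<close>.  A weighted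
  digraph is a digraph without parallel arcs (its arcs are pairs of nodes) together with an
  adjacency matrix whose support is exactly the set of arcs.  Self-loops are allowed.
\<close>

definition weighted_digraph :: "'n::finite pair_pre_digraph \<Rightarrow> real^'n^'n \<Rightarrow> bool" where
  "weighted_digraph G A \<longleftrightarrow>
     pverts G = UNIV \<and>
     (\<forall>i j. ((i, j) \<in> parcs G \<longrightarrow> A $ i $ j > 0) \<and> ((i, j) \<notin> parcs G \<longrightarrow> A $ i $ j = 0))"

definition weight_balanced :: "real^'n^'n::finite \<Rightarrow> bool" where
  "weight_balanced A \<longleftrightarrow> (\<forall>i. (\<Sum>j\<in>UNIV. A $ i $ j) = (\<Sum>j\<in>UNIV. A $ j $ i))"

definition wout_degree :: "real^'n^'n::finite \<Rightarrow> 'n \<Rightarrow> real" where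
  "wout_degree A i = (\<Sum>j\<in>UNIV. A $ i $ j)"

definition max_wout_degree :: "real^'n^'n::finite \<Rightarrow> real" where
  "max_wout_degree A = Max (range (wout_degree A))"

definition wout_degree_matrix :: "real^'n^'n::finite \<Rightarrow> real^'n^'n" where
  "wout_degree_matrix A = (\<chi> i j. if i = j then wout_degree A i else 0)"

definition laplacian :: "real^'n^'n::finite \<Rightarrow> real^'n^'n" where
  "laplacian A = wout_degree_matrix A - A"

end

theory Submission
  imports Defs
begin

text \<open>
  The combination \<open>w = v + \<alpha> x\<close> decouples the system: the Laplacian terms cancel, so
  \<open>w(k+1) = (1 - \<delta>\<alpha>) w(k)\<close>, and \<open>w\<close> decays geometrically because \<open>0 < \<delta>\<alpha> < 1\<close>.  What remains is
  \<open>x(k+1) = P x(k) - \<delta> w(k)\<close> with \<open>P = I - \<delta>\<beta>L\<close>, a consensus iteration with a decaying input.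

  Weight balance makes the columns of \<open>L\<close> sum to zero, hence the mean of \<open>v\<close> is conserved.  As
  the mean of \<open>w\<close> vanishes in the limit, the mean of \<open>x\<close> tends to \<open>-1/\<alpha>\<close> times the initial mean
  of \<open>v\<close>.  It remains to see that the disagreement \<open>z = x - mean x\<close> dies out.

  The step-size bound makes \<open>P\<close> doubly stochastic with a positive diagonal.  Row by row,
  \<open>(P y)\<^sub>i\<close> is a weighted mean of the entries of \<open>y\<close>, and the square of a mean is the mean of the
  squares minus a variance; summing over the rows shows that \<open>P\<close> does not increase the Euclidean
  norm, and that the norm is preserved only if \<open>y\<close> takes equal values at the ends of every edge
  (\<open>norm_square_doubly_stochastic\<close>, \<open>doubly_stochastic_isometric_imp_locally_constant\<close>).
  By strong connectivity \<open>y\<close> is then constant, so \<open>P\<close> strictly shrinks every nonzero vector of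
  mean zero (\<open>laplacian_step_strict_contraction\<close>).  By compactness of the unit sphere it does so by
  a uniform factor \<open>\<rho> < 1\<close> (\<open>contraction_factor_on_subspace\<close>), and a contraction with geometrically
  decaying input tends to zero (\<open>geometrically_perturbed_contraction_tendsto_0\<close>).  Finally
  \<open>v = w - \<alpha> x\<close> gives the limit of \<open>v\<close>.
\<close>

section \<open>Linear recursions driven by a geometrically decaying input\<close>

text \<open>
  The norm of \<open>f\<close> attains its maximum on the unit sphere of \<open>S\<close>, which is compact, and the
  maximum is below one; scaling carries the bound from the sphere to \<open>S\<close>.
\<close>

lemma contraction_factor_on_subspace:
  fixes f :: "'a::euclidean_space \<Rightarrow> 'a"
  assumes lin: "linear f" and sub: "subspace S"
    and strict: "\<And>y. y \<in> S \<Longrightarrow> y \<noteq> 0 \<Longrightarrow> norm (f y) < norm y"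
  obtains \<rho> where "0 \<le> \<rho>" "\<rho> < 1" "\<And>y. y \<in> S \<Longrightarrow> norm (f y) \<le> \<rho> * norm y"
proof -
  define K where "K = S \<inter> sphere 0 1"
  have "compact K"
    unfolding K_def by (intro closed_Int_compact closed_subspace sub compact_sphere)
  obtain \<rho> where \<rho>: "0 \<le> \<rho>" "\<rho> < 1" "\<And>y. y \<in> K \<Longrightarrow> norm (f y) \<le> \<rho>"
    \<comment> \<open>The sphere is empty when \<open>S\<close> is the zero subspace.\<close>
  proof (cases "K = {}")
    case True
    show ?thesis by (rule that[of 0]) (use True in auto)
  next
    case False
    have "continuous_on K (\<lambda>y. norm (f y))"
      by (intro continuous_intros linear_continuous_on_compose[OF _ lin])
    then obtain y0 where y0: "y0 \<in> K" "\<And>y. y \<in> K \<Longrightarrow> norm (f y) \<le> norm (f y0)"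
      using continuous_attains_sup[OF \<open>compact K\<close> False] by blast
    have "norm (f y0) < 1"
      using strict[of y0] y0(1) by (cases "y0 = 0") (auto simp: K_def)
    then show ?thesis by (intro that[of "norm (f y0)"] y0(2)) auto
  qed
  have "norm (f y) \<le> \<rho> * norm y" if "y \<in> S" for y
  proof (cases "y = 0")
    case True
    then show ?thesis using linear_0[OF lin] by simp
  next
    case False
    have "inverse (norm y) *\<^sub>R y \<in> K"
      using False that sub by (auto simp: K_def subspace_scale)
    from \<rho>(3)[OF this] show ?thesis
      using False by (simp add: linear_scale[OF lin] field_simps)
  qed
  with \<rho> that show ?thesis by blast
qed

text \<open>
  Adding a suitable multiple \<open>M q^k\<close> of the input to \<open>s k\<close> absorbs the input: the sum shrinks by a
  fixed factor \<open>r\<close> in every step.  This needs \<open>r\<close> strictly above \<open>q\<close>, so that \<open>M\<close> can be chosen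
  with \<open>C + M q = r M\<close>, and is insensitive to whether \<open>\<rho>\<close> or \<open>q\<close> is the larger rate.
\<close>

lemma geometrically_perturbed_contraction_tendsto_0:
  fixes s :: "nat \<Rightarrow> real"
  assumes nonneg: "\<And>k. 0 \<le> s k" and \<rho>: "0 \<le> \<rho>" "\<rho> < 1" and q: "0 \<le> q" "q < 1" and C: "0 \<le> C"
    and step: "\<And>k. s (Suc k) \<le> \<rho> * s k + C * q ^ k"
  shows "s \<longlonglongrightarrow> 0"
proof -
  obtain r where "max \<rho> q < r" "r < 1"
    using dense[of "max \<rho> q" 1] \<rho> q by auto
  then have r: "\<rho> \<le> r" "q < r" "r < 1"
    by auto
  define M where "M = C / (r - q)"
  have M: "0 \<le> M" "C + M * q = r * M"
    using r C by (auto simp: M_def field_simps)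
  have bound: "s k + M * q ^ k \<le> r ^ k * (s 0 + M)" for k
  proof (induction k)
    case (Suc k)
    have "s (Suc k) + M * q ^ Suc k \<le> \<rho> * s k + (C + M * q) * q ^ k"
      using step[of k] by (simp add: algebra_simps)
    also have "\<dots> \<le> r * (s k + M * q ^ k)"
      using mult_right_mono[OF r(1) nonneg[of k]] by (simp add: M(2) algebra_simps)
    also have "\<dots> \<le> r * (r ^ k * (s 0 + M))"
      using Suc r q by (intro mult_left_mono) auto
    finally show ?case by (simp add: algebra_simps)
  qed simp
  have upper: "s k \<le> r ^ k * (s 0 + M)" for k
  proof -
    have "0 \<le> M * q ^ k" using M(1) q by simp
    then show ?thesis using bound[of k] by linarith
  qed
  have lim: "(\<lambda>k. r ^ k * (s 0 + M)) \<longlonglongrightarrow> 0"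
    using r q by (intro tendsto_mult_left_zero LIMSEQ_realpow_zero) auto
  show ?thesis
    by (rule tendsto_sandwich[OF _ _ tendsto_const lim]) (simp_all add: nonneg upper)
qed

section \<open>Averaging matrices\<close>

definition doubly_stochastic :: "real^'n^'n::finite \<Rightarrow> bool" where
  "doubly_stochastic P \<longleftrightarrow> (\<forall>i j. 0 \<le> P $ i $ j) \<and>
     (\<forall>i. (\<Sum>j\<in>UNIV. P $ i $ j) = 1) \<and> (\<forall>j. (\<Sum>i\<in>UNIV. P $ i $ j) = 1)"

text \<open>
  This is Jensen's inequality for the square with its defect, the variance, made explicit; the
  defect is what decides the equality case below.
\<close>

lemma square_of_weighted_mean:
  fixes p y :: "'a \<Rightarrow> real"
  assumes "sum p I = 1"
  defines "m \<equiv> \<Sum>j\<in>I. p j * y j"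
  shows "m\<^sup>2 = (\<Sum>j\<in>I. p j * (y j)\<^sup>2) - (\<Sum>j\<in>I. p j * (y j - m)\<^sup>2)"
proof -
  have "(\<Sum>j\<in>I. p j * (y j - m)\<^sup>2)
      = (\<Sum>j\<in>I. p j * (y j)\<^sup>2 - 2 * m * (p j * y j) + m\<^sup>2 * p j)"
    by (intro sum.cong) (auto simp: power2_eq_square algebra_simps)
  also have "\<dots> = (\<Sum>j\<in>I. p j * (y j)\<^sup>2) - 2 * m * m + m\<^sup>2"
    by (simp add: sum.distrib sum_subtractf assms(1) m_def flip: sum_distrib_left)
  finally show ?thesis by (simp add: power2_eq_square)
qed

text \<open>
  The row sums make every entry of \<open>P *v y\<close> a weighted mean; the column sums then turn the total
  of the mean squares back into the squared norm of \<open>y\<close>.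
\<close>

lemma norm_square_doubly_stochastic:
  fixes y :: "real^'n::finite"
  assumes "doubly_stochastic P"
  shows "(norm (P *v y))\<^sup>2
    = (norm y)\<^sup>2 - (\<Sum>i\<in>UNIV. \<Sum>j\<in>UNIV. P $ i $ j * (y $ j - (P *v y) $ i)\<^sup>2)"
proof -
  have norm_sq: "(norm z)\<^sup>2 = (\<Sum>i\<in>UNIV. (z $ i)\<^sup>2)" for z :: "real^'n"
    unfolding power2_norm_eq_inner by (simp add: inner_vec_def power2_eq_square)
  have "((P *v y) $ i)\<^sup>2 = (\<Sum>j\<in>UNIV. P $ i $ j * (y $ j)\<^sup>2)
      - (\<Sum>j\<in>UNIV. P $ i $ j * (y $ j - (P *v y) $ i)\<^sup>2)" for i
    using square_of_weighted_mean[of "\<lambda>j. P $ i $ j" UNIV "\<lambda>j. y $ j"] assms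
    by (simp add: doubly_stochastic_def matrix_vector_mult_def)
  moreover have "(\<Sum>i\<in>UNIV. \<Sum>j\<in>UNIV. P $ i $ j * (y $ j)\<^sup>2) = (\<Sum>j\<in>UNIV. (y $ j)\<^sup>2)"
    using assms by (subst sum.swap) (simp add: doubly_stochastic_def flip: sum_distrib_right)
  ultimately show ?thesis by (simp add: norm_sq sum_subtractf)
qed

text \<open>
  If no norm is lost, all row variances vanish, so \<open>y $ j\<close> equals the mean \<open>(P *v y) $ i\<close> whenever
  row \<open>i\<close> puts weight on \<open>j\<close>.  The diagonal weight identifies this mean with \<open>y $ i\<close>.
\<close>

lemma doubly_stochastic_isometric_imp_locally_constant:
  fixes y :: "real^'n::finite"
  assumes P: "doubly_stochastic P" and norm: "norm y \<le> norm (P *v y)"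
    and pos: "P $ i $ i > 0" "P $ i $ j > 0"
  shows "y $ i = y $ j"
proof -
  have nonneg: "0 \<le> P $ i $ j * (y $ j - (P *v y) $ i)\<^sup>2" for i j
    using P by (simp add: doubly_stochastic_def)
  have "(norm y)\<^sup>2 \<le> (norm (P *v y))\<^sup>2"
    using norm by (simp add: power_mono)
  then have "(\<Sum>i\<in>UNIV. \<Sum>j\<in>UNIV. P $ i $ j * (y $ j - (P *v y) $ i)\<^sup>2) \<le> 0"
    using norm_square_doubly_stochastic[OF P, of y] by simp
  then have "(\<Sum>i\<in>UNIV. \<Sum>j\<in>UNIV. P $ i $ j * (y $ j - (P *v y) $ i)\<^sup>2) = 0"
    using nonneg by (simp add: antisym sum_nonneg)
  then have "P $ i $ j * (y $ j - (P *v y) $ i)\<^sup>2 = 0" for i j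
    using nonneg by (simp add: sum_nonneg_eq_0_iff sum_nonneg)
  then have "P $ i $ j = 0 \<or> y $ j = (P *v y) $ i" for i j
    by (metis eq_iff_diff_eq_0 mult_eq_0_iff power_eq_0_iff)
  with pos show ?thesis by (metis less_irrefl)
qed

lemma strongly_connected_constant:
  fixes G :: "'n pair_pre_digraph"
  assumes "strongly_connected (with_proj G)" and "pverts G = UNIV"
    and edge: "\<And>i j. (i, j) \<in> parcs G \<Longrightarrow> y i = y j"
  shows "y i = y j"
proof -
  have "i \<rightarrow>\<^sup>*\<^bsub>with_proj G\<^esub> j"
    using assms(1,2) by (auto simp: strongly_connected_def)
  then show ?thesis
    unfolding reachable_def
    by (induction rule: rtrancl_on_induct) (auto dest: edge simp: arcs_ends_def arc_to_ends_def)
qed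

section \<open>The Laplacian step\<close>

lemma sum_laplacian_row: "(\<Sum>j\<in>UNIV. laplacian A $ i $ j) = 0"
  by (simp add: laplacian_def wout_degree_matrix_def wout_degree_def sum_subtractf)

lemma sum_laplacian_column:
  assumes "weight_balanced A"
  shows "(\<Sum>i\<in>UNIV. laplacian A $ i $ j) = 0"
  using assms
  by (simp add: laplacian_def wout_degree_matrix_def wout_degree_def sum_subtractf weight_balanced_def)

context
  fixes G :: "'n::finite pair_pre_digraph" and A :: "real^'n^'n" and \<epsilon> :: real
  assumes G: "weighted_digraph G A" and bal: "weight_balanced A"
    and \<epsilon>: "\<epsilon> > 0" "\<epsilon> * max_wout_degree A < 1"
begin

lemma weight_nonneg: "0 \<le> A $ i $ j"
  using G unfolding weighted_digraph_def by (metis less_eq_real_def)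

text \<open>
  This is what the degree bound on the step size is for: the diagonal entry is
  \<open>1 - \<epsilon> d\<^sub>i + \<epsilon> a\<^sub>i\<^sub>i\<close> with \<open>d\<^sub>i\<close> the out-degree, and a self-loop can only increase it.
\<close>

lemma laplacian_step_diagonal_pos: "(mat 1 - \<epsilon> *\<^sub>R laplacian A) $ i $ i > 0"
proof -
  have "wout_degree A i \<le> max_wout_degree A"
    unfolding max_wout_degree_def by (intro Max_ge) auto
  then have "\<epsilon> * wout_degree A i < 1"
    using \<epsilon> by (meson le_less_trans mult_left_mono less_imp_le)
  moreover have "0 \<le> \<epsilon> * A $ i $ i"
    using \<epsilon> weight_nonneg by simp
  ultimately show ?thesis
    by (simp add: laplacian_def wout_degree_matrix_def mat_def algebra_simps)
qed

lemma laplacian_step_off_diagonal: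
  "i \<noteq> j \<Longrightarrow> (mat 1 - \<epsilon> *\<^sub>R laplacian A) $ i $ j = \<epsilon> * A $ i $ j"
  by (simp add: laplacian_def wout_degree_matrix_def mat_def)

lemma doubly_stochastic_laplacian_step: "doubly_stochastic (mat 1 - \<epsilon> *\<^sub>R laplacian A)"
proof -
  have "0 \<le> (mat 1 - \<epsilon> *\<^sub>R laplacian A) $ i $ j" for i j
    using laplacian_step_diagonal_pos[of i] laplacian_step_off_diagonal[of i j] weight_nonneg[of i j] \<epsilon>(1)
    by (cases "i = j") (auto simp del: vector_minus_component intro: less_imp_le)
  moreover have "(\<Sum>j\<in>UNIV. (mat 1 - \<epsilon> *\<^sub>R laplacian A) $ i $ j) = 1" for i
    by (simp add: sum_subtractf sum_laplacian_row mat_def flip: sum_distrib_left)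
  moreover have "(\<Sum>i\<in>UNIV. (mat 1 - \<epsilon> *\<^sub>R laplacian A) $ i $ j) = 1" for j
    by (simp add: sum_subtractf sum_laplacian_column[OF bal] mat_def flip: sum_distrib_left)
  ultimately show ?thesis by (simp add: doubly_stochastic_def)
qed

text \<open>
  A vector that keeps its norm agrees along all edges, hence is constant on a strongly connected
  digraph; a constant vector with sum zero is zero.
\<close>

lemma laplacian_step_strict_contraction:
  assumes conn: "strongly_connected (with_proj G)"
    and mean: "(\<Sum>i\<in>UNIV. y $ i) = 0" and "y \<noteq> 0"
  shows "norm ((mat 1 - \<epsilon> *\<^sub>R laplacian A) *v y) < norm y"
proof (rule ccontr)
  assume "\<not> ?thesis"
  then have norm: "norm y \<le> norm ((mat 1 - \<epsilon> *\<^sub>R laplacian A) *v y)" by simp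
  have "y $ i = y $ j" if "(i, j) \<in> parcs G" for i j
  proof (cases "i = j")
    case False
    have "A $ i $ j > 0" using G that by (simp add: weighted_digraph_def)
    then have "(mat 1 - \<epsilon> *\<^sub>R laplacian A) $ i $ j > 0"
      using \<epsilon>(1) by (simp only: laplacian_step_off_diagonal[OF False] mult_pos_pos)
    then show ?thesis
      by (rule doubly_stochastic_isometric_imp_locally_constant
          [OF doubly_stochastic_laplacian_step norm laplacian_step_diagonal_pos])
  qed simp
  then have const: "y $ i = y $ j" for i j
    using strongly_connected_constant[OF conn, of "\<lambda>i. y $ i"] G
    by (simp add: weighted_digraph_def)
  have "real CARD('n) * y $ i = 0" for i
  proof -
    have "(\<Sum>j\<in>UNIV. y $ j) = (\<Sum>j::'n\<in>UNIV. y $ i)"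
      by (intro sum.cong refl const)
    with mean show ?thesis by simp
  qed
  then have "y = 0" by (simp add: vec_eq_iff)
  with \<open>y \<noteq> 0\<close> show False by simp
qed

end

section \<open>Convergence\<close>

theorem lemma4p6:
  fixes G :: "'n::finite pair_pre_digraph"
    and A :: "real^'n^'n"
    and \<alpha> \<beta> \<delta> :: real
    and x v :: "nat \<Rightarrow> real^'n"
  assumes "CARD('n) \<ge> 2"
    and "weighted_digraph G A"
    and "strongly_connected (with_proj G)"
    and "weight_balanced A"
    and "\<alpha> > 0" and "\<beta> > 0"
    and "\<delta> \<in> {0<..<min (inverse \<alpha>) (inverse \<beta> * inverse (max_wout_degree A))}"
    and "\<And>k i. x (k + 1) $ i =
           x k $ i - \<delta> * \<alpha> * x k $ i
             - \<delta> * \<beta> * (\<Sum>j\<in>UNIV. laplacian A $ i $ j * x k $ j) - \<delta> * v k $ i"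
    and "\<And>k i. v (k + 1) $ i =
           v k $ i + \<delta> * \<alpha> * \<beta> * (\<Sum>j\<in>UNIV. laplacian A $ i $ j * x k $ j)"
  shows "\<forall>i. ((\<lambda>k. x k $ i) \<longlonglongrightarrow> - (inverse \<alpha> / real CARD('n)) * (\<Sum>j\<in>UNIV. v 0 $ j)) \<and>
             ((\<lambda>k. v k $ i) \<longlonglongrightarrow> 1 / real CARD('n) * (\<Sum>j\<in>UNIV. v 0 $ j))"
proof -
  define q where "q = 1 - \<delta> * \<alpha>"
  define P where "P = mat 1 - (\<delta> * \<beta>) *\<^sub>R laplacian A"
  define w where "w k = v k + \<alpha> *\<^sub>R x k" for k
  define mean where "mean y = (\<Sum>i\<in>UNIV. y $ i) / real CARD('n)" for y :: "real^'n"
  define z where "z k = x k - vec (mean (x k))" for k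

  have \<delta>: "\<delta> > 0" "\<delta> < inverse \<alpha>" "\<delta> < inverse \<beta> * inverse (max_wout_degree A)"
    using assms(7) by auto
  have q: "0 \<le> q" "q < 1"
    using \<delta> \<open>\<alpha> > 0\<close> by (auto simp: q_def field_simps)
  \<comment> \<open>If the maximal degree were nonpositive, its inverse would be too and no positive \<open>\<delta>\<close> could
      satisfy the bound; positivity is needed to multiply the bound out.\<close>
  have dmax: "max_wout_degree A > 0"
    using \<delta> \<open>\<beta> > 0\<close> by (smt (verit) inverse_nonpositive_iff_nonpositive mult_nonneg_nonpos positive_imp_inverse_positive)
  then have \<epsilon>: "\<delta> * \<beta> > 0" "\<delta> * \<beta> * max_wout_degree A < 1"
    using \<delta> \<open>\<beta> > 0\<close> by (auto simp: field_simps)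

  have x_eq: "x (Suc k) $ i = x k $ i - \<delta> * \<alpha> * x k $ i
      - \<delta> * \<beta> * (laplacian A *v x k) $ i - \<delta> * v k $ i" for k i
    using assms(8)[where i = i] by (simp add: matrix_vector_mult_def)
  have v_eq: "v (Suc k) $ i = v k $ i + \<delta> * \<alpha> * \<beta> * (laplacian A *v x k) $ i" for k i
    using assms(9)[where i = i] by (simp add: matrix_vector_mult_def)
  have x_step: "x (Suc k) = P *v x k - \<delta> *\<^sub>R w k" for k
    unfolding vec_eq_iff P_def w_def matrix_vector_mult_diff_rdistrib
    by (simp add: x_eq algebra_simps flip: scaleR_matrix_vector_assoc)
  have w_step: "w (Suc k) = q *\<^sub>R w k" for k
    by (simp add: vec_eq_iff x_eq v_eq w_def q_def algebra_simps)
  have w: "w k = q ^ k *\<^sub>R w 0" for k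
    by (induction k) (simp_all add: w_step)

  have mean_lin: "mean (a *\<^sub>R y) = a * mean y" "mean (y + y') = mean y + mean y'"
    "mean (y - y') = mean y - mean y'" for a y y'
    by (simp_all add: mean_def sum.distrib sum_subtractf add_divide_distrib diff_divide_distrib
        flip: sum_distrib_left)
  have mean_P: "mean (P *v y) = mean y" for y
  proof -
    have "(\<Sum>i\<in>UNIV. (P *v y) $ i) = (\<Sum>j\<in>UNIV. \<Sum>i\<in>UNIV. P $ i $ j * y $ j)"
      unfolding matrix_vector_mult_def by (simp, rule sum.swap)
    also have "\<dots> = (\<Sum>j\<in>UNIV. y $ j)"
      using doubly_stochastic_laplacian_step[OF assms(2,4) \<epsilon>]
      by (simp add: P_def[symmetric] doubly_stochastic_def flip: sum_distrib_right)
    finally show ?thesis by (simp add: mean_def)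
  qed
  have P_vec: "P *v vec c = vec c" for c
    using doubly_stochastic_laplacian_step[OF assms(2,4) \<epsilon>]
    by (simp add: vec_eq_iff matrix_vector_mult_def P_def[symmetric] doubly_stochastic_def
        flip: sum_distrib_right)

  \<comment> \<open>Obtained from the decoupled recursions for \<open>x\<close> and \<open>w\<close>, in which \<open>L\<close> occurs only through \<open>P\<close>,
      and \<open>P\<close> preserves means.\<close>
  have mean_v: "mean (v k) = mean (v 0)" for k
  proof (induction k)
    case (Suc k)
    have "mean (v (Suc k)) = mean (w (Suc k)) - \<alpha> * mean (x (Suc k))"
      by (simp add: w_def mean_lin)
    also have "\<dots> = q * mean (w k) - \<alpha> * (mean (x k) - \<delta> * mean (w k))"
      by (simp add: w_step x_step mean_lin mean_P)
    also have "\<dots> = mean (v k)"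
      by (simp add: q_def w_def mean_lin algebra_simps)
    finally show ?case using Suc by simp
  qed simp
  have mean_x: "mean (x k) = (q ^ k * mean (w 0) - mean (v 0)) / \<alpha>" for k
    using arg_cong[OF w[of k], of mean] \<open>\<alpha> > 0\<close> mean_v[of k]
    by (simp add: w_def[of k] mean_lin field_simps)
  have q_pow: "(\<lambda>k. q ^ k) \<longlonglongrightarrow> 0"
    using q by (intro LIMSEQ_realpow_zero) auto
  have lim_mean: "(\<lambda>k. mean (x k)) \<longlonglongrightarrow> - mean (v 0) / \<alpha>"
    unfolding mean_x using \<open>\<alpha> > 0\<close> q by (auto intro!: tendsto_eq_intros q_pow)

  obtain \<rho> where \<rho>: "0 \<le> \<rho>" "\<rho> < 1"
    "\<And>y. y \<in> {y. (\<Sum>i\<in>UNIV. y $ i) = 0} \<Longrightarrow> norm (P *v y) \<le> \<rho> * norm y"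
  proof (rule contraction_factor_on_subspace[of "(*v) P" "{y. (\<Sum>i\<in>UNIV. y $ i) = 0}"])
    show "subspace {y::real^'n. (\<Sum>i\<in>UNIV. y $ i) = 0}"
      by (simp add: subspace_def sum.distrib flip: sum_distrib_left)
    show "norm (P *v y) < norm y" if "y \<in> {y. (\<Sum>i\<in>UNIV. y $ i) = 0}" "y \<noteq> 0" for y
      using laplacian_step_strict_contraction[OF assms(2,4) \<epsilon> assms(3)] that by (simp add: P_def)
  qed auto
  \<comment> \<open>\<open>P\<close> fixes constant vectors and preserves means, so it commutes with removing the mean.\<close>
  have z_step: "z (Suc k) = P *v z k - q ^ k *\<^sub>R (\<delta> *\<^sub>R (w 0 - vec (mean (w 0))))" for k
    by (simp add: z_def x_step mean_lin mean_P matrix_vector_mult_diff_distrib P_vec w[of k])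
       (simp add: vec_eq_iff algebra_simps)
  have "(\<lambda>k. norm (z k)) \<longlonglongrightarrow> 0"
  proof (rule geometrically_perturbed_contraction_tendsto_0[OF _ \<rho>(1,2) q])
    fix k
    have "(\<Sum>i\<in>UNIV. z k $ i) = 0"
      by (simp add: z_def mean_def sum_subtractf)
    then have "norm (P *v z k) \<le> \<rho> * norm (z k)"
      by (intro \<rho>(3)) simp
    moreover have "norm (z (Suc k)) \<le> norm (P *v z k) + norm (q ^ k *\<^sub>R (\<delta> *\<^sub>R (w 0 - vec (mean (w 0)))))"
      unfolding z_step by (rule norm_triangle_ineq4)
    ultimately show "norm (z (Suc k)) \<le> \<rho> * norm (z k) + norm (\<delta> *\<^sub>R (w 0 - vec (mean (w 0)))) * q ^ k"
      using q by (simp add: abs_mult mult_ac)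
  qed auto
  then have lim_z: "(\<lambda>k. z k $ i) \<longlonglongrightarrow> 0" for i
    using tendsto_vec_nth[OF tendsto_norm_zero_cancel, of z sequentially i] by simp

  have lim_x: "(\<lambda>k. x k $ i) \<longlonglongrightarrow> - mean (v 0) / \<alpha>" for i
    using tendsto_add[OF lim_z[of i] lim_mean] by (simp add: z_def)
  have "(\<lambda>k. q ^ k * w 0 $ i - \<alpha> * x k $ i) \<longlonglongrightarrow> mean (v 0)" for i
    using tendsto_diff[OF tendsto_mult_left_zero[OF q_pow, of "w 0 $ i"]
        tendsto_mult_left[OF lim_x[of i], of \<alpha>]] \<open>\<alpha> > 0\<close> by simp
  moreover have "v k $ i = q ^ k * w 0 $ i - \<alpha> * x k $ i" for k i
    using arg_cong[OF w[of k], of "\<lambda>u. u $ i"] by (simp add: w_def[of k])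
  ultimately have lim_v: "(\<lambda>k. v k $ i) \<longlonglongrightarrow> mean (v 0)" for i
    by simp
  show ?thesis
    using lim_x lim_v by (simp add: mean_def field_simps)
qed

end
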